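(* Let $\alpha$ and $N$ be relatively prime natural numbers such that $\alpha-1$ divides $N$, and let $$S_1=\min\left\{\alpha,\left\lfloor \frac{N}{\alpha+1}\right\rfloor\right\},\qquad S_2=\left\lfloor\frac{\alpha-1}{2}\right\rfloor .$$ Then there is a permutation $\pi$ of $\{1,\ldots,N\}$ such that: (a) for all $i,j\in\{1,\ldots,N\}$ with $i\neq j$ and $|(i-j)\bmod N|\le S_1$, one has $|(\pi(i)-\pi(j))\bmod N|\ge S_1$; and (b) for all $i\in\{1,\ldots,N\}$, $|(i-\pi(i))\bmod N|\ge S_2$.
   Context: For an integer $x$, $|x \bmod N|$ denotes the cyclic distance of $x$ from $0$ modulo $N$, i.e. $\min\{r,\,N-r\}$ where $r\in\{0,1,\ldots,N-1\}$ is the residue of $x$ modulo $N$. *)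

theory Defs
  imports Complex_Main "HOL-Combinatorics.Permutations"
begin

text \<open>For \<open>N > 0\<close>, \<open>x mod int N\<close> is the residue in \<open>{0..N-1}\<close>, also for negative \<open>x\<close>.\<close>

definition cyc_dist :: "nat \<Rightarrow> int \<Rightarrow> int" where
  "cyc_dist N x = min (x mod int N) (int N - x mod int N)"

definition S1 :: "nat \<Rightarrow> nat \<Rightarrow> int" where
  "S1 \<alpha> N = min (int \<alpha>) \<lfloor>real N / (real \<alpha> + 1)\<rfloor>"

definition S2 :: "nat \<Rightarrow> int" where
  "S2 \<alpha> = \<lfloor>(real \<alpha> - 1) / 2\<rfloor>"

end

theory Submission
  imports Defs "HOL-Number_Theory.Cong"
begin

text \<open>
  The permutation is the affine map \<open>i \<mapsto> \<alpha> i + c\<close> modulo \<open>N\<close> with \<open>c = \<lfloor>(\<alpha> - 1) / 2\<rfloor>\<close>.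
  A difference \<open>d\<close> with \<open>1 \<le> \<bar>d\<bar> \<le> S\<^sub>1\<close> is sent to \<open>\<alpha> d\<close>, and
  \<open>S\<^sub>1 \<le> \<alpha> \<le> \<alpha> \<bar>d\<bar> \<le> \<alpha> N / (\<alpha> + 1) \<le> N - S\<^sub>1\<close>.
  The displacement \<open>i - \<pi> i\<close> is congruent to \<open>-c\<close> modulo the divisor \<open>\<alpha> - 1\<close> of \<open>N\<close>, so its
  cyclic distance modulo \<open>N\<close> is at least that of \<open>c\<close> modulo \<open>\<alpha> - 1\<close>.
\<close>

lemma cyc_dist_cong: "[x = y] (mod int N) \<Longrightarrow> cyc_dist N x = cyc_dist N y"
  by (simp add: cyc_dist_def cong_def)

lemma cyc_dist_nonneg: "N > 0 \<Longrightarrow> cyc_dist N x \<ge> 0"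
  by (simp add: cyc_dist_def pos_mod_bound less_imp_le)

text \<open>The witness is the residue or the residue minus \<open>N\<close>, whichever is smaller
  in absolute value.\<close>

lemma cyc_dist_representative:
  assumes "N > 0"
  obtains y where "[y = x] (mod int N)" "cyc_dist N x = \<bar>y\<bar>"
proof (cases "x mod int N \<le> int N - x mod int N")
  case True
  then show ?thesis
    using assms by (intro that[of "x mod int N"]) (auto simp: cyc_dist_def cong_def)
next
  case False
  moreover have "x mod int N < int N"
    using assms by simp
  ultimately show ?thesis
    by (intro that[of "x mod int N - int N"]) (auto simp: cyc_dist_def cong_def)
qed

text \<open>For \<open>t > 0\<close> the bounds force \<open>\<bar>y\<bar> < N\<close>, so the
  residue is \<open>y\<close> or \<open>y + N\<close> and the minimum is taken over
  \<open>\<bar>y\<bar>\<close> and \<open>N - \<bar>y\<bar>\<close>.\<close>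

lemma cyc_dist_ge:
  assumes "N > 0" "t \<le> \<bar>y\<bar>" "\<bar>y\<bar> \<le> int N - t"
  shows "t \<le> cyc_dist N y"
proof (cases "t \<le> 0")
  case True
  then show ?thesis
    using cyc_dist_nonneg[OF assms(1), of y] by linarith
next
  case False
  show ?thesis
  proof (cases "y \<ge> 0")
    case True
    then have "y mod int N = y"
      using assms False by (intro mod_pos_pos_trivial) auto
    then show ?thesis
      using assms True by (simp add: cyc_dist_def)
  next
    case y: False
    have "y mod int N = (y + int N) mod int N"
      by simp
    also have "\<dots> = y + int N"
      using assms False y by (intro mod_pos_pos_trivial) auto
    finally show ?thesis
      using assms y by (simp add: cyc_dist_def)
  qed
qed

text \<open>Every multiple of \<open>N\<close> is a multiple of \<open>m\<close>, so the nearest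
  multiple of \<open>m\<close> is at least as close to \<open>x\<close>.\<close>

lemma cyc_dist_mono_dvd:
  assumes "m dvd N" "N > 0"
  shows "cyc_dist m x \<le> cyc_dist N x"
proof -
  define r where "r = x mod int N"
  have m: "m > 0"
    using assms by (auto intro: Nat.gr0I)
  have r: "0 \<le> r" "r < int N"
    using assms by (auto simp: r_def)
  have s: "r mod int m = x mod int m"
    using assms unfolding r_def by (simp add: mod_mod_cancel)
  obtain k where k: "int N = int m * k"
    using assms by (metis dvdE of_nat_mult)
  have q: "r = int m * (r div int m) + x mod int m"
    using s by (metis mult_div_mod_eq)
  have "0 \<le> x mod int m"
    using m by simp
  \<comment> \<open>The block of length \<open>m\<close> containing \<open>r\<close> starts before
    \<open>N = m * k\<close>; since \<open>N\<close> is a block boundary, the block also ends by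
    \<open>N\<close>.\<close>
  then have "int m * (r div int m) < int m * k"
    using q r k by linarith
  then have "r div int m + 1 \<le> k"
    using m by simp
  then have "int m * (r div int m + 1) \<le> int m * k"
    by (intro mult_left_mono) auto
  then have "int m - x mod int m \<le> int N - r"
    using q k by (simp add: algebra_simps)
  moreover have "x mod int m \<le> r"
    using s r(1) by (metis zmod_le_nonneg_dividend)
  ultimately show ?thesis
    unfolding cyc_dist_def r_def[symmetric] by linarith
qed

lemma S1_bounds:
  "S1 \<alpha> N \<le> int \<alpha>" "int \<alpha> * S1 \<alpha> N \<le> int N - S1 \<alpha> N"
proof -
  have "real_of_int (S1 \<alpha> N) \<le> real N / (real \<alpha> + 1)"
    unfolding S1_def by linarith
  then have "real_of_int (S1 \<alpha> N) * (real \<alpha> + 1) \<le> real N"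
    by (simp add: field_simps)
  then have "real_of_int (S1 \<alpha> N * (int \<alpha> + 1)) \<le> real_of_int (int N)"
    by simp
  then show "int \<alpha> * S1 \<alpha> N \<le> int N - S1 \<alpha> N"
    by (simp only: of_int_le_iff) (simp add: algebra_simps)
qed (simp add: S1_def)

lemma S2_eq: "S2 \<alpha> = (int \<alpha> - 1) div 2"
proof -
  have "(real \<alpha> - 1) / 2 = real_of_int (int \<alpha> - 1) / real_of_int 2"
    by simp
  then show ?thesis
    unfolding S2_def by (simp only: floor_divide_of_int_eq)
qed

lemma eq_if_dvd_diff:
  assumes "i \<in> {1..N}" "j \<in> {1..N}" "int N dvd int i - int j"
  shows "i = j"
proof -
  have "\<bar>int i - int j\<bar> < int N"
    using assms(1,2) unfolding atLeastAtMost_iff by linarith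
  then have "int i - int j = 0"
    using assms(3) by (metis dvd_imp_le_int abs_of_nat not_less)
  then show ?thesis
    by simp
qed

text \<open>Coprimality lets \<open>a\<close> be cancelled modulo \<open>N\<close>, which gives
  injectivity; finiteness of \<open>{1..N}\<close> then gives surjectivity.\<close>

lemma affine_permutation_mod:
  fixes a b :: int
  assumes "N > 0" "coprime a (int N)"
  obtains \<pi> where "\<pi> permutes {1..N}"
    "\<And>i. i \<in> {1..N} \<Longrightarrow> [int (\<pi> i) = a * int i + b] (mod int N)"
proof -
  \<comment> \<open>Subtracting 1 before reducing and adding it back afterwards selects
    representatives in \<open>{1..N}\<close>, with \<open>N\<close> standing for residue 0. Outside
    this range \<open>permutes\<close> requires the identity.\<close>
  define \<pi> where "\<pi> i = (if i \<in> {1..N} then Suc (nat ((a * int i + b - 1) mod int N)) else i)" for i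
  have int_\<pi>: "int (\<pi> i) = (a * int i + b - 1) mod int N + 1" if "i \<in> {1..N}" for i
    using that assms by (simp add: \<pi>_def)
  have cong: "[int (\<pi> i) = a * int i + b] (mod int N)" if "i \<in> {1..N}" for i
    unfolding int_\<pi>[OF that] by (simp add: cong_def mod_add_left_eq)
  have maps: "\<pi> ` {1..N} \<subseteq> {1..N}"
  proof (rule image_subsetI)
    fix i assume i: "i \<in> {1..N}"
    have "(a * int i + b - 1) mod int N < int N"
      using assms by simp
    then have "int (\<pi> i) \<le> int N"
      using int_\<pi>[OF i] by linarith
    then show "\<pi> i \<in> {1..N}"
      using i by (simp add: \<pi>_def)
  qed
  have inj: "inj_on \<pi> {1..N}"
  proof (rule inj_onI)
    fix i j assume ij: "i \<in> {1..N}" "j \<in> {1..N}" "\<pi> i = \<pi> j"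
    have "[a * int i + b = a * int j + b] (mod int N)"
      using cong[OF ij(1)] cong[OF ij(2)] ij(3) by (metis cong_sym cong_trans)
    then have "[int i = int j] (mod int N)"
      using assms by (simp add: cong_add_rcancel cong_mult_lcancel)
    then show "i = j"
      using eq_if_dvd_diff[OF ij(1,2)] by (simp add: cong_iff_dvd_diff)
  qed
  have "bij_betw \<pi> {1..N} {1..N}"
    using inj maps by (simp add: bij_betw_def endo_inj_surj)
  then have "\<pi> permutes {1..N}"
    by (rule bij_imp_permutes) (simp only: \<pi>_def if_False)
  then show ?thesis
    using cong that by blast
qed

theorem theorem1:
  fixes \<alpha> N :: nat
  assumes "N > 0"
    and "coprime \<alpha> N"
    and "(int \<alpha> - 1) dvd int N"
  shows "\<exists>\<pi>. \<pi> permutes {1..N} \<and>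
    (\<forall>i\<in>{1..N}. \<forall>j\<in>{1..N}. i \<noteq> j \<and> cyc_dist N (int i - int j) \<le> S1 \<alpha> N \<longrightarrow>
       cyc_dist N (int (\<pi> i) - int (\<pi> j)) \<ge> S1 \<alpha> N) \<and>
    (\<forall>i\<in>{1..N}. cyc_dist N (int i - int (\<pi> i)) \<ge> S2 \<alpha>)"
proof -
  obtain \<pi> where perm: "\<pi> permutes {1..N}"
    and \<pi>: "\<And>i. i \<in> {1..N} \<Longrightarrow> [int (\<pi> i) = int \<alpha> * int i + S2 \<alpha>] (mod int N)"
    using affine_permutation_mod[of N "int \<alpha>" "S2 \<alpha>"] assms by auto
  have "S1 \<alpha> N \<le> cyc_dist N (int (\<pi> i) - int (\<pi> j))"
    if i: "i \<in> {1..N}" and j: "j \<in> {1..N}" and "i \<noteq> j"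
      and close: "cyc_dist N (int i - int j) \<le> S1 \<alpha> N" for i j
  proof -
    obtain d where d: "[d = int i - int j] (mod int N)" "cyc_dist N (int i - int j) = \<bar>d\<bar>"
      using cyc_dist_representative[OF assms(1)] .
    have "\<not> int N dvd int i - int j"
      using eq_if_dvd_diff[OF i j] \<open>i \<noteq> j\<close> by blast
    then have "d \<noteq> 0"
      using d(1) by (auto simp: cong_0_iff dest: cong_sym)
    then have "int \<alpha> * 1 \<le> int \<alpha> * \<bar>d\<bar>"
      by (intro mult_left_mono) auto
    moreover have "int \<alpha> * \<bar>d\<bar> \<le> int \<alpha> * S1 \<alpha> N"
      using close d(2) by (intro mult_left_mono) auto
    \<comment> \<open>\<open>cyc_dist_ge\<close> applies with \<open>y = \<alpha> * d\<close>: its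
      lower bound uses \<open>d \<noteq> 0\<close>, its upper bound the closeness of
      \<open>i\<close> and \<open>j\<close>.\<close>
    ultimately have "S1 \<alpha> N \<le> cyc_dist N (int \<alpha> * d)"
      using S1_bounds[of \<alpha> N] by (intro cyc_dist_ge assms) (auto simp: abs_mult)
    moreover have "[int (\<pi> i) - int (\<pi> j) = int \<alpha> * d] (mod int N)"
    proof -
      have "[int (\<pi> i) - int (\<pi> j) = int \<alpha> * (int i - int j)] (mod int N)"
        using cong_diff[OF \<pi>[OF i] \<pi>[OF j]] by (simp add: algebra_simps)
      also have "[int \<alpha> * (int i - int j) = int \<alpha> * d] (mod int N)"
        using d(1) by (intro cong_mult cong_refl) (rule cong_sym)
      finally show ?thesis .
    qed
    ultimately show ?thesis
      by (simp add: cyc_dist_cong)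
  qed
  moreover have "S2 \<alpha> \<le> cyc_dist N (int i - int (\<pi> i))" if i: "i \<in> {1..N}" for i
  \<comment> \<open>For \<open>\<alpha> = 0\<close> the bound \<open>S2 \<alpha>\<close> is -1;
    excluding this case keeps the natural subtraction in \<open>m\<close> from truncating.\<close>
  proof (cases "\<alpha> = 0")
    case True
    then show ?thesis
      using cyc_dist_nonneg[OF assms(1), of "int i - int (\<pi> i)"] by (simp add: S2_eq)
  next
    case False
    define m where "m = \<alpha> - 1"
    have m: "int \<alpha> = int m + 1"
      using False by (simp add: m_def)
    \<comment> \<open>If \<open>m\<close> were 0, then 0 would divide the positive
      \<open>N\<close>.\<close>
    have "m dvd N" "m > 0"
      using assms m by (auto intro: Nat.gr0I)
    have "[int (\<pi> i) = int \<alpha> * int i + S2 \<alpha>] (mod int m)"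
      using \<pi>[OF i] \<open>m dvd N\<close> by (meson cong_dvd_modulus int_dvd_int_iff)
    then have "[int i - int (\<pi> i) = int i - (int \<alpha> * int i + S2 \<alpha>)] (mod int m)"
      by (intro cong_diff cong_refl)
    \<comment> \<open>Since \<open>\<alpha>\<close> is 1 modulo \<open>m\<close>, the dependence on
      \<open>i\<close> disappears.\<close>
    also have "int i - (int \<alpha> * int i + S2 \<alpha>) = - S2 \<alpha> + int m * (- int i)"
      by (simp add: m algebra_simps)
    also have "[\<dots> = - S2 \<alpha>] (mod int m)"
      by (simp only: cong_def mod_mult_self2)
    finally have "cyc_dist m (int i - int (\<pi> i)) = cyc_dist m (- S2 \<alpha>)"
      by (rule cyc_dist_cong)
    \<comment> \<open>Halving \<open>m\<close> and rounding down gives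
      \<open>S2 \<alpha> \<le> m - S2 \<alpha>\<close>.\<close>
    moreover have "S2 \<alpha> \<le> cyc_dist m (- S2 \<alpha>)"
      using \<open>m > 0\<close> m by (intro cyc_dist_ge) (auto simp: S2_eq)
    ultimately show ?thesis
      using cyc_dist_mono_dvd[OF \<open>m dvd N\<close> assms(1)] by (metis order_trans)
  qed
  ultimately show ?thesis
    using perm by blast
qed

end
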